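(* Let $\Psi_R:\mathbb{R}^d\to\mathbb{R}$ be a suitable potential, let $\pi^\ast$ be the probability density on $\mathbb{R}^d$ with $\pi^\ast(u)\propto\exp(-\Psi_R(u))$, let $D=dJ$, and let $\pi(U)=\prod_{j=1}^J\pi^\ast(u^{(j)})$ for $U=(u^{(1)},\dots,u^{(J)})\in(\mathbb{R}^d)^J\cong\mathbb{R}^D$. Consider the corrected interacting particle system $$\dot U=S(U)\nabla\ln\pi(U)+\frac{d+1}{J}(U-\bar U)+\sqrt{2S(U)}\,\dot{\mathbf{W}},$$ where $\bar u=\frac1J\sum_{j=1}^J u^{(j)}$, $\bar U\in\mathbb{R}^D$ consists of $J$ copies of $\bar u$, and $S(U)\in\mathbb{R}^{D\times D}$ is the block diagonal matrix with $J$ diagonal blocks each equal to the empirical covariance $C(U)=\frac1J\sum_{k=1}^J(u^{(k)}-\bar u)(u^{(k)}-\bar u)^{\rm T}\in\mathbb{R}^{d\times d}$. Then the Fokker--Planck equation associated to the time evolution of the joint density $\mu$ of $U$ under this system is of the form $$\partial_t\mu=\nabla\cdot\big(\mu\,S\nabla\{\ln\mu-\ln\pi\}\big)=\nabla\cdot\Big(\mu\,S\nabla\frac{\delta V}{\delta\mu}\Big),$$ where the energy functional $V$ is the Kullback--Leibler divergence between $\mu$ and $\pi$, given by $$V(\mu)=\int_{\mathbb{R}^D}\mu(U)\{\ln\mu(U)-\ln\pi(U)\}\,\mathrm{d}U.$$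
   Context: $d$ is the dimension of the state space of a single particle and $J$ is the number of particles. $\mathbf{W}$ is a standard $D$-dimensional Brownian motion, $\sqrt{2S(U)}$ is the matrix square root, and the stochastic differential equation is understood in the Itô sense: the Fokker--Planck equation associated with $\dot U=b(U)+\sqrt{2S(U)}\,\dot{\mathbf{W}}$ is $$\partial_t\mu=-\nabla\cdot(b\mu)+\sum_{i,j=1}^D\partial_i\partial_j(S_{ij}\mu).$$ All gradients and divergences are taken with respect to $U\in\mathbb{R}^D$. $\delta V/\delta\mu$ denotes the functional derivative (first variation) of $V$ with respect to $\mu$, i.e. formally the function, determined up to an additive constant, with $\frac{\mathrm{d}}{\mathrm{d}\varepsilon}V(\mu+\varepsilon\varphi)\big|_{\varepsilon=0}=\int_{\mathbb{R}^D}\frac{\delta V}{\delta\mu}\,\varphi\,\mathrm{d}U$ for perturbations $\varphi$ with $\int_{\mathbb{R}^D}\varphi\,\mathrm{d}U=0$. *)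

theory Defs
  imports "HOL-Probability.Information"
begin

section \<open>Differential operators on \<open>\<real>\<^sup>n\<close>\<close>

definition partial :: "'n::finite \<Rightarrow> (real^'n \<Rightarrow> real) \<Rightarrow> real^'n \<Rightarrow> real" where
  "partial i f x = deriv (\<lambda>h. f (x + h *\<^sub>R axis i 1)) 0"

definition grad :: "(real^'n \<Rightarrow> real) \<Rightarrow> real^'n \<Rightarrow> real^'n" where
  "grad f x = (\<chi> i. partial i f x)"

definition divergence :: "(real^'n \<Rightarrow> real^'n) \<Rightarrow> real^'n \<Rightarrow> real" where
  "divergence F x = (\<Sum>i\<in>UNIV. partial i (\<lambda>y. F y $ i) x)"

definition twice_differentiable :: "(real^'n \<Rightarrow> real) \<Rightarrow> bool" where
  "twice_differentiable f \<longleftrightarrow>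
     (\<forall>x. f differentiable (at x)) \<and> (\<forall>i x. partial i f differentiable (at x))"


section \<open>Fokker--Planck equation\<close>

text \<open>The Fokker--Planck operator of the Ito equation \<open>dU = b(U) dt + sqrt(2 S(U)) dW\<close>, where the
  matrix square root enters only through its square \<open>2 S(U)\<close>.\<close>

definition fokker_planck ::
    "(real^'n \<Rightarrow> real^'n) \<Rightarrow> (real^'n \<Rightarrow> real^'n^'n) \<Rightarrow> (real^'n \<Rightarrow> real) \<Rightarrow> real^'n \<Rightarrow> real" where
  "fokker_planck b S \<rho> x =
     - divergence (\<lambda>y. \<rho> y *\<^sub>R b y) x
     + (\<Sum>i\<in>UNIV. \<Sum>j\<in>UNIV. partial i (partial j (\<lambda>y. S y $ i $ j * \<rho> y)) x)"

definition flow_form ::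
    "(real^'n \<Rightarrow> real^'n^'n) \<Rightarrow> (real^'n \<Rightarrow> real) \<Rightarrow> (real^'n \<Rightarrow> real) \<Rightarrow> real^'n \<Rightarrow> real" where
  "flow_form S \<rho> f = divergence (\<lambda>y. \<rho> y *\<^sub>R (S y *v grad f y))"

text \<open>The curve \<open>\<mu>\<close> satisfies \<open>\<partial>\<^sub>t \<mu> = r\<close> at all times in \<open>T\<close>, classically and pointwise.\<close>

definition evolves :: "real set \<Rightarrow> (real \<Rightarrow> 'a \<Rightarrow> real) \<Rightarrow> (real \<Rightarrow> 'a \<Rightarrow> real) \<Rightarrow> bool" where
  "evolves T r \<mu> \<longleftrightarrow>
     (\<forall>t\<in>T. \<forall>x. ((\<lambda>s. \<mu> s x) has_real_derivative r t x) (at t within T))"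


section \<open>Functional derivative\<close>

text \<open>The perturbations \<open>\<phi>\<close> of mass zero along which \<open>\<mu> + \<epsilon> \<phi>\<close> stays a density for all small
  \<open>\<epsilon>\<close> of either sign, so that a functional on densities can be differentiated at \<open>\<epsilon> = 0\<close>.\<close>

definition perturbation :: "('a::euclidean_space \<Rightarrow> real) \<Rightarrow> ('a \<Rightarrow> real) \<Rightarrow> bool" where
  "perturbation \<mu> \<phi> \<longleftrightarrow>
     integrable lborel \<phi> \<and> (LINT x|lborel. \<phi> x) = 0 \<and>
     (\<forall>\<^sub>F \<epsilon> in at 0. \<forall>x. 0 \<le> \<mu> x + \<epsilon> * \<phi> x)"

text \<open>A relation rather than a function: \<open>f\<close> is determined only up to an additive constant
  (and a null set).\<close>

definition has_functional_derivative ::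
    "(('a::euclidean_space \<Rightarrow> real) \<Rightarrow> real) \<Rightarrow> ('a \<Rightarrow> real) \<Rightarrow> ('a \<Rightarrow> real) \<Rightarrow> bool" where
  "has_functional_derivative V \<mu> f \<longleftrightarrow>
     (\<forall>\<phi>. perturbation \<mu> \<phi> \<longrightarrow>
        integrable lborel (\<lambda>x. f x * \<phi> x) \<and>
        ((\<lambda>\<epsilon>. V (\<lambda>x. \<mu> x + \<epsilon> * \<phi> x)) has_real_derivative (LINT x|lborel. f x * \<phi> x)) (at 0))"


section \<open>The interacting particle system\<close>

text \<open>With \<open>d = CARD('d)\<close> and \<open>J = CARD('J)\<close>, the space \<open>\<real>\<^sup>D\<close>, \<open>D = d J\<close>, has its coordinates
  indexed by the pairs (particle, component).\<close>

definition particle :: "real^('J \<times> 'd) \<Rightarrow> 'J::finite \<Rightarrow> real^'d::finite" where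
  "particle U j = (\<chi> a. U $ (j, a))"

definition mean :: "real^('J::finite \<times> 'd::finite) \<Rightarrow> real^'d" where
  "mean U = (1 / real CARD('J)) *\<^sub>R (\<Sum>j\<in>UNIV. particle U j)"

definition mean_copies :: "real^('J::finite \<times> 'd::finite) \<Rightarrow> real^('J \<times> 'd)" where
  "mean_copies U = (\<chi> p. mean U $ snd p)"

definition empirical_cov :: "real^('J::finite \<times> 'd::finite) \<Rightarrow> real^'d^'d" where
  "empirical_cov U = (\<chi> a b. (1 / real CARD('J)) *
     (\<Sum>k\<in>UNIV. (particle U k - mean U) $ a * (particle U k - mean U) $ b))"

definition block_cov :: "real^('J::finite \<times> 'd::finite) \<Rightarrow> real^('J \<times> 'd)^('J \<times> 'd)" where
  "block_cov U = (\<chi> p q. if fst p = fst q then empirical_cov U $ snd p $ snd q else 0)"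

definition target :: "(real^'d::finite \<Rightarrow> real) \<Rightarrow> real^'d \<Rightarrow> real" where
  "target \<Psi> u = exp (- \<Psi> u) / (LINT v|lborel. exp (- \<Psi> v))"

definition joint_target :: "(real^'d \<Rightarrow> real) \<Rightarrow> real^('J::finite \<times> 'd::finite) \<Rightarrow> real" where
  "joint_target \<Psi> U = (\<Prod>j\<in>UNIV. target \<Psi> (particle U j))"

definition corrected_drift ::
    "(real^'d \<Rightarrow> real) \<Rightarrow> real^('J::finite \<times> 'd::finite) \<Rightarrow> real^('J \<times> 'd)" where
  "corrected_drift \<Psi> U =
     block_cov U *v grad (\<lambda>W. ln (joint_target \<Psi> W)) U
     + ((real CARD('d) + 1) / real CARD('J)) *\<^sub>R (U - mean_copies U)"

definition kl_energy :: "('a::euclidean_space \<Rightarrow> real) \<Rightarrow> ('a \<Rightarrow> real) \<Rightarrow> real" where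
  "kl_energy \<pi> \<mu> = (LINT U|lborel. \<mu> U * (ln (\<mu> U) - ln (\<pi> U)))"

text \<open>By the next two facts \<open>2 S(U)\<close> has a symmetric square root.\<close>

lemma transpose_block_cov: "transpose (block_cov U) = block_cov U"
  by (auto simp: transpose_def block_cov_def empirical_cov_def vec_eq_iff mult.commute)

lemma block_cov_psd:
  fixes U x :: "real^('J::finite \<times> 'd::finite)"
  shows "0 \<le> x \<bullet> (block_cov U *v x)"
proof -
  define y where "y k a = (particle U k - mean U) $ a" for k a
  have "x \<bullet> (block_cov U *v x) = (\<Sum>j\<in>UNIV. \<Sum>a\<in>UNIV. x $ (j, a) *
      (\<Sum>l\<in>UNIV. \<Sum>b\<in>UNIV. (if j = l then empirical_cov U $ a $ b else 0) * x $ (l, b)))"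
    unfolding inner_vec_def matrix_vector_mult_def block_cov_def
    by (simp add: UNIV_Times_UNIV[symmetric] sum.cartesian_product' del: UNIV_Times_UNIV cong: if_cong)
  also have "\<dots> = (\<Sum>j\<in>UNIV. \<Sum>a\<in>UNIV. x $ (j, a) * (\<Sum>b\<in>UNIV. empirical_cov U $ a $ b * x $ (j, b)))"
  proof -
    have "(\<Sum>l\<in>UNIV. \<Sum>b\<in>UNIV. (if j = l then empirical_cov U $ a $ b else 0) * x $ (l, b))
        = (\<Sum>l\<in>UNIV. if j = l then (\<Sum>b\<in>UNIV. empirical_cov U $ a $ b * x $ (l, b)) else 0)" for j a
      by (rule sum.cong) auto
    then show ?thesis by simp
  qed
  also have "\<dots> = (\<Sum>j\<in>UNIV. (1 / real CARD('J)) * (\<Sum>k\<in>UNIV. (\<Sum>a\<in>UNIV. y k a * x $ (j, a))\<^sup>2))"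
  proof (rule sum.cong[OF refl])
    fix j
    have "(\<Sum>k\<in>UNIV. (\<Sum>a\<in>UNIV. y k a * x $ (j, a))\<^sup>2)
        = (\<Sum>k\<in>UNIV. \<Sum>a\<in>UNIV. \<Sum>b\<in>UNIV. y k a * x $ (j, a) * (y k b * x $ (j, b)))"
      by (simp add: power2_eq_square sum_product)
    also have "\<dots> = (\<Sum>a\<in>UNIV. \<Sum>k\<in>UNIV. \<Sum>b\<in>UNIV. y k a * x $ (j, a) * (y k b * x $ (j, b)))"
      by (rule sum.swap)
    also have "\<dots> = (\<Sum>a\<in>UNIV. \<Sum>b\<in>UNIV. \<Sum>k\<in>UNIV. y k a * x $ (j, a) * (y k b * x $ (j, b)))"
      by (rule sum.cong[OF refl], rule sum.swap)
    finally show "(\<Sum>a\<in>UNIV. x $ (j, a) * (\<Sum>b\<in>UNIV. empirical_cov U $ a $ b * x $ (j, b)))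
        = (1 / real CARD('J)) * (\<Sum>k\<in>UNIV. (\<Sum>a\<in>UNIV. y k a * x $ (j, a))\<^sup>2)"
      by (simp add: empirical_cov_def y_def sum_distrib_left sum_distrib_right sum_divide_distrib mult_ac)
  qed
  also have "\<dots> \<ge> 0"
    by (intro sum_nonneg mult_nonneg_nonneg) auto
  finally show ?thesis .
qed

end

theory Submission
  imports Defs
begin

text \<open>Expanding \<open>\<partial>\<^sub>i\<partial>\<^sub>j(S\<^sub>i\<^sub>j\<mu>)\<close> once turns the Fokker--Planck operator into the divergence of
  \<open>S\<nabla>\<mu> + \<mu> div S - \<mu> b\<close>, where \<open>div S\<close> is taken row by row. For the block covariance \<open>div S\<close> is exactly the
  correction \<open>(d + 1)/J (U - mean)\<close>, so only \<open>\<mu> S\<nabla>(ln \<mu> - ln \<pi>)\<close> is left.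
  For the first variation, an admissible \<open>\<phi>\<close> satisfies \<open>\<bar>\<phi>\<bar> \<le> K \<mu>\<close>; writing \<open>\<mu> + \<epsilon>\<phi> = \<mu>(1 + x)\<close>, the bound
  \<open>0 \<le> (1 + x) ln (1 + x) - x \<le> x\<^sup>2\<close> makes the remainder of \<open>V\<close> of order \<open>\<epsilon>\<^sup>2\<close>.\<close>

section \<open>Partial derivatives\<close>

text \<open>\<open>partial\<close> is a choice made by \<open>deriv\<close>; a total derivative,
  evaluated on a basis vector, determines it. The rules for sums, products and \<open>ln\<close>
  below read their result off this one.\<close>

lemma partial_eqI:
  assumes "(f has_derivative f') (at x)"
  shows "partial i f x = f' (axis i 1)"
proof -
  have "((\<lambda>h. f (x + h *\<^sub>R axis i 1)) has_derivative (\<lambda>h. f' (h *\<^sub>R axis i 1))) (at 0)"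
    using assms
    by (intro has_derivative_compose[where f="\<lambda>h. x + h *\<^sub>R axis i 1" and g=f])
       (auto intro!: derivative_eq_intros)
  moreover have "(\<lambda>h. f' (h *\<^sub>R axis i 1)) = (*) (f' (axis i 1))"
    using has_derivative_linear[OF assms] by (auto simp: linear_cmul mult.commute)
  ultimately show ?thesis
    unfolding partial_def by (intro DERIV_imp_deriv) (simp add: has_field_derivative_def)
qed

lemma partial_add:
  assumes "f differentiable (at x)" "g differentiable (at x)"
  shows "partial i (\<lambda>x. f x + g x) x = partial i f x + partial i g x"
proof -
  obtain f' g' where "(f has_derivative f') (at x)" "(g has_derivative g') (at x)"
    using assms by (auto simp: differentiable_def)
  from partial_eqI[OF has_derivative_add[OF this]] this show ?thesis by (simp add: partial_eqI)
qed

lemma partial_diff: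
  assumes "f differentiable (at x)" "g differentiable (at x)"
  shows "partial i (\<lambda>x. f x - g x) x = partial i f x - partial i g x"
proof -
  obtain f' g' where "(f has_derivative f') (at x)" "(g has_derivative g') (at x)"
    using assms by (auto simp: differentiable_def)
  from partial_eqI[OF has_derivative_diff[OF this]] this show ?thesis by (simp add: partial_eqI)
qed

lemma partial_mult:
  assumes "f differentiable (at x)" "g differentiable (at x)"
  shows "partial i (\<lambda>x. f x * g x) x = partial i f x * g x + f x * partial i g x"
proof -
  obtain f' g' where "(f has_derivative f') (at x)" "(g has_derivative g') (at x)"
    using assms by (auto simp: differentiable_def)
  from partial_eqI[OF has_derivative_mult[OF this]] this show ?thesis by (simp add: partial_eqI)
qed

lemma partial_sum:
  assumes "\<And>k. k \<in> A \<Longrightarrow> f k differentiable (at x)"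
  shows "partial i (\<lambda>x. \<Sum>k\<in>A. f k x) x = (\<Sum>k\<in>A. partial i (f k) x)"
proof -
  obtain f' where f': "\<And>k. k \<in> A \<Longrightarrow> (f k has_derivative f' k) (at x)"
    using assms unfolding differentiable_def by metis
  have "partial i (\<lambda>x. \<Sum>k\<in>A. f k x) x = (\<Sum>k\<in>A. f' k (axis i 1))"
    by (intro partial_eqI has_derivative_sum f')
  also have "\<dots> = (\<Sum>k\<in>A. partial i (f k) x)"
    by (intro sum.cong refl partial_eqI[symmetric] f')
  finally show ?thesis .
qed

lemma partial_const: "partial i (\<lambda>x. c) x = 0"
  by (simp add: partial_def)

lemma partial_ln:
  assumes "f differentiable (at x)" "0 < f x"
  shows "partial i (\<lambda>x. ln (f x)) x = partial i f x / f x"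
proof -
  obtain f' where f': "(f has_derivative f') (at x)"
    using assms by (auto simp: differentiable_def)
  have "((\<lambda>x. ln (f x)) has_derivative (\<lambda>h. f' h * inverse (f x))) (at x)"
    using assms f' by (auto intro!: derivative_eq_intros)
  from partial_eqI[OF this] f' show ?thesis by (simp add: partial_eqI divide_inverse)
qed

lemma partial_linear:
  assumes "bounded_linear f"
  shows "partial i f x = f (axis i 1)"
  by (intro partial_eqI bounded_linear_imp_has_derivative assms)

section \<open>Closure properties of twice differentiable functions\<close>

lemma twice_differentiable_const: "twice_differentiable (\<lambda>x. c)"
  by (simp add: twice_differentiable_def partial_const[abs_def])

text \<open>Takes the partial derivatives as a pointwise formula \<open>g\<close>, the shape in
  which \<open>partial_add\<close>, \<open>partial_mult\<close> and \<open>partial_sum\<close>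
  supply them.\<close>

lemma twice_differentiableI:
  assumes "\<And>x. f differentiable (at x)" "\<And>i x. partial i f x = g i x" "\<And>i x. g i differentiable (at x)"
  shows "twice_differentiable f"
proof -
  have "partial i f = g i" for i by (simp add: fun_eq_iff assms)
  with assms show ?thesis by (simp add: twice_differentiable_def)
qed

lemma twice_differentiableD:
  assumes "twice_differentiable f"
  shows "f differentiable (at x)" "partial i f differentiable (at x)"
  using assms by (auto simp: twice_differentiable_def)

lemma twice_differentiable_linear:
  "bounded_linear f \<Longrightarrow> twice_differentiable f"
  by (rule twice_differentiableI[OF _ partial_linear])
     (auto simp: bounded_linear_imp_differentiable)

lemma twice_differentiable_add:
  assumes "twice_differentiable f" "twice_differentiable g"
  shows "twice_differentiable (\<lambda>x. f x + g x)"
  by (rule twice_differentiableI[OF _ partial_add])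
     (intro differentiable_add differentiable_mult twice_differentiableD assms)+

lemma twice_differentiable_mult:
  assumes "twice_differentiable f" "twice_differentiable g"
  shows "twice_differentiable (\<lambda>x. f x * g x)"
  by (rule twice_differentiableI[OF _ partial_mult])
     (intro differentiable_add differentiable_mult twice_differentiableD assms)+

lemma twice_differentiable_sum:
  assumes "\<And>k. k \<in> A \<Longrightarrow> twice_differentiable (f k)"
  shows "twice_differentiable (\<lambda>x. \<Sum>k\<in>A. f k x)"
proof (cases "finite A")
  case True
  then show ?thesis
    by (intro twice_differentiableI[OF _ partial_sum])
       (use True in \<open>auto intro!: differentiable_sum dest: twice_differentiableD[OF assms]\<close>)
\<comment> \<open>A sum over an infinite set is \<open>0\<close> by convention, hence
  constant.\<close>
qed (simp add: twice_differentiable_const)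

lemma twice_differentiable_imp_continuous_on:
  "twice_differentiable f \<Longrightarrow> continuous_on A f"
  by (auto simp: twice_differentiable_def differentiable_imp_continuous_within
      intro!: continuous_at_imp_continuous_on)

section \<open>Fokker--Planck operators in flow form\<close>

text \<open>Keeping \<open>S\<close> and \<open>L\<close> general isolates what the particle system
  has to satisfy: its drift must be \<open>S \<nabla> L\<close> plus the row divergence of
  \<open>S\<close>. Positivity of \<open>\<rho>\<close> makes
  \<open>\<rho> \<nabla> ln \<rho>\<close> equal to \<open>\<nabla> \<rho>\<close>.\<close>

lemma fokker_planck_eq_flow_form:
  fixes S :: "real^'n \<Rightarrow> real^'n^'n" and L \<rho> :: "real^'n \<Rightarrow> real"
  assumes S: "\<And>i j. twice_differentiable (\<lambda>y. S y $ i $ j)"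
    and L: "twice_differentiable L" and \<rho>: "twice_differentiable \<rho>" and pos: "\<And>y. 0 < \<rho> y"
  shows "fokker_planck (\<lambda>y. S y *v grad L y + (\<chi> i. \<Sum>j\<in>UNIV. partial j (\<lambda>z. S z $ i $ j) y)) S \<rho> x
    = flow_form S \<rho> (\<lambda>y. ln (\<rho> y) - L y) x"
proof -
  \<comment> \<open>\<open>c\<close>, \<open>A\<close> and \<open>B\<close> are the components of
    \<open>div S\<close>, \<open>S \<nabla> L\<close> and \<open>S \<nabla> \<rho>\<close>.\<close>
  define c where "c i y = (\<Sum>j\<in>UNIV. partial j (\<lambda>z. S z $ i $ j) y)" for i y
  define A where "A i y = (\<Sum>j\<in>UNIV. S y $ i $ j * partial j L y)" for i y
  define B where "B i y = (\<Sum>j\<in>UNIV. S y $ i $ j * partial j \<rho> y)" for i y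
  have d: "(\<lambda>y. S y $ i $ j) differentiable (at y)" "partial k (\<lambda>y. S y $ i $ j) differentiable (at y)"
      "L differentiable (at y)" "partial k L differentiable (at y)"
      "\<rho> differentiable (at y)" "partial k \<rho> differentiable (at y)" for i j k y
    using assms by (auto simp: twice_differentiable_def)
  have dc: "c i differentiable (at y)" and dA: "A i differentiable (at y)"
    and dB: "B i differentiable (at y)" for i y
    unfolding c_def[abs_def] A_def[abs_def] B_def[abs_def] by (auto intro!: d differentiable_sum differentiable_mult)
  have drift: "(S y *v grad L y + (\<chi> i. \<Sum>j\<in>UNIV. partial j (\<lambda>z. S z $ i $ j) y)) $ i = A i y + c i y" for i y
    by (simp add: matrix_vector_mult_def grad_def A_def c_def)
  have flux: "(\<rho> y *\<^sub>R (S y *v grad (\<lambda>y. ln (\<rho> y) - L y) y)) $ i = B i y - \<rho> y * A i y" for i y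
  proof -
    have "partial j (\<lambda>y. ln (\<rho> y) - L y) y = partial j \<rho> y / \<rho> y - partial j L y" for j
    proof -
      have "(\<lambda>y. ln (\<rho> y)) differentiable (at y)"
        using d(5)[of y] pos[of y] unfolding differentiable_def by (auto intro!: has_derivative_ln)
      then show ?thesis by (simp add: partial_diff d partial_ln pos)
    qed
    moreover have "\<rho> y * (w * (u / \<rho> y - v)) = w * u - \<rho> y * (w * v)" for u v w
      using pos[of y] by (simp add: field_simps)
    ultimately show ?thesis
      by (simp add: matrix_vector_mult_def grad_def A_def B_def sum_distrib_left sum_subtractf)
  qed
  have "(\<Sum>j\<in>UNIV. partial i (partial j (\<lambda>y. S y $ i $ j * \<rho> y)) x)
      = partial i (\<lambda>y. \<rho> y * c i y + B i y) x" for i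
  proof -
    \<comment> \<open>The outer derivative moves out of the sum over \<open>j\<close>, so that the
      inner one can be expanded as a function before it is differentiated again.\<close>
    have "(\<Sum>j\<in>UNIV. partial i (partial j (\<lambda>y. S y $ i $ j * \<rho> y)) x)
      = partial i (\<lambda>y. \<Sum>j\<in>UNIV. partial j (\<lambda>y. S y $ i $ j * \<rho> y) y) x"
      by (subst partial_sum) (intro twice_differentiableD twice_differentiable_mult S \<rho>, rule refl)
    also have "(\<lambda>y. \<Sum>j\<in>UNIV. partial j (\<lambda>y. S y $ i $ j * \<rho> y) y) = (\<lambda>y. \<rho> y * c i y + B i y)"
      by (simp add: partial_mult d c_def B_def sum.distrib sum_distrib_left mult.commute add.commute)
    finally show ?thesis .
  qed
  then have "fokker_planck (\<lambda>y. S y *v grad L y + (\<chi> i. \<Sum>j\<in>UNIV. partial j (\<lambda>z. S z $ i $ j) y)) S \<rho> x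
      = (\<Sum>i\<in>UNIV. partial i (\<lambda>y. \<rho> y * c i y + B i y) x - partial i (\<lambda>y. \<rho> y * (A i y + c i y)) x)"
    by (simp add: fokker_planck_def divergence_def drift sum_subtractf del: vector_add_component)
  \<comment> \<open>After the product rule the two copies of the derivative of
    \<open>\<rho> c\<close> cancel.\<close>
  also have "\<dots> = (\<Sum>i\<in>UNIV. partial i (\<lambda>y. B i y - \<rho> y * A i y) x)"
    by (intro sum.cong refl) (simp add: partial_add partial_diff partial_mult d dA dB dc algebra_simps)
  also have "\<dots> = flow_form S \<rho> (\<lambda>y. ln (\<rho> y) - L y) x"
    by (simp only: flow_form_def divergence_def flux)
  finally show ?thesis .
qed

section \<open>The empirical covariance\<close>

lemma bounded_linear_particle: "bounded_linear (\<lambda>U. particle U j)"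
  by (auto simp: linear_conv_bounded_linear[symmetric] particle_def vec_eq_iff intro!: linearI)

lemma partial_compose_particle:
  assumes "\<Psi> differentiable (at (particle U j))"
  shows "partial p (\<lambda>U. \<Psi> (particle U j)) U
    = (if fst p = j then partial (snd p) \<Psi> (particle U j) else 0)"
proof -
  obtain \<Psi>' where \<Psi>': "(\<Psi> has_derivative \<Psi>') (at (particle U j))"
    using assms by (auto simp: differentiable_def)
  \<comment> \<open>A basis vector of the product space moves only the particle
    \<open>fst p\<close>, along component \<open>snd p\<close>; every other particle sees the zero
    direction.\<close>
  have "particle (axis p 1) j = (if fst p = j then axis (snd p) 1 else 0)"
    by (auto simp: particle_def axis_def vec_eq_iff prod_eq_iff)
  moreover have "\<Psi>' 0 = 0"
    using has_derivative_linear[OF \<Psi>'] by (rule linear_0)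
  ultimately show ?thesis
    using partial_eqI[OF has_derivative_compose[OF
        bounded_linear_imp_has_derivative[OF bounded_linear_particle] \<Psi>'], of p]
    by (simp add: partial_eqI[OF \<Psi>'])
qed

lemma twice_differentiable_compose_particle:
  fixes \<Psi> :: "real^'d::finite \<Rightarrow> real"
  assumes "twice_differentiable \<Psi>"
  shows "twice_differentiable (\<lambda>U. \<Psi> (particle U j))"
proof -
  have chain: "(\<lambda>U. f (particle U j)) differentiable (at U)" if "\<And>u. f differentiable (at u)"
    for f :: "real^'d \<Rightarrow> real" and U
    using differentiable_chain_at[OF bounded_linear_imp_differentiable[OF bounded_linear_particle] that]
    by (simp add: o_def)
  show ?thesis
  proof (rule twice_differentiableI[OF _ partial_compose_particle])
    show "(\<lambda>U. if fst p = j then partial (snd p) \<Psi> (particle U j) else 0) differentiable (at U)" for p U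
      by (cases "fst p = j") (simp_all add: chain twice_differentiableD(2)[OF assms])
  qed (intro chain twice_differentiableD assms)+
qed

text \<open>As a scalar function of \<open>U\<close> a centred coordinate is a linear functional
  with constant partial derivatives, and the covariance is quadratic in such functionals.\<close>

definition centred :: "'J \<Rightarrow> 'd \<Rightarrow> real^('J::finite \<times> 'd::finite) \<Rightarrow> real" where
  "centred k a U = (particle U k - mean U) $ a"

lemma empirical_cov_centred:
  "empirical_cov U $ a $ b = 1 / real CARD('J) * (\<Sum>k\<in>UNIV. centred k a U * centred k b U)"
  for U :: "real^('J::finite \<times> 'd::finite)"
  by (simp add: empirical_cov_def centred_def)

lemma bounded_linear_centred: "bounded_linear (centred k a)"
  by (auto simp: linear_conv_bounded_linear[symmetric] centred_def[abs_def] mean_def particle_def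
      sum.distrib add_divide_distrib sum_distrib_left algebra_simps intro!: linearI)

lemma sum_centred: "(\<Sum>k\<in>UNIV. centred k a U) = 0"
  by (simp add: centred_def mean_def sum_subtractf)

text \<open>A unit step in component \<open>b\<close> of particle \<open>l\<close> moves that
  particle by \<open>1\<close> and the mean by \<open>1/J\<close>, in that component only.\<close>

lemma partial_centred:
  "partial (l, b) (centred k a) U = (if a = b then (if k = l then 1 else 0) - 1 / real CARD('J) else 0)"
  for U :: "real^('J::finite \<times> 'd::finite)"
proof -
  have ax: "axis (l, b) (1::real) $ (j, a) = (if j = l then if a = b then 1 else 0 else 0)" for j
    by (auto simp: axis_def)
  show ?thesis
    unfolding partial_linear[OF bounded_linear_centred]
    by (simp add: centred_def mean_def particle_def ax)
qed

lemma twice_differentiable_empirical_cov: "twice_differentiable (\<lambda>U. empirical_cov U $ a $ b)"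
  unfolding empirical_cov_centred
  by (intro twice_differentiable_mult twice_differentiable_sum twice_differentiable_const
      twice_differentiable_linear bounded_linear_centred)

lemma twice_differentiable_block_cov: "twice_differentiable (\<lambda>U. block_cov U $ p $ q)"
  by (cases "fst p = fst q")
     (simp_all add: block_cov_def twice_differentiable_empirical_cov twice_differentiable_const)

text \<open>A row divergence differentiates each entry in its column index \<open>b\<close> only. In
  the product rule the Kronecker delta picks the summand \<open>k = l\<close>, and the
  \<open>1/J\<close> terms coming from the mean vanish by \<open>sum_centred\<close>.\<close>

lemma partial_empirical_cov:
  "partial (l, b) (\<lambda>U. empirical_cov U $ a $ b) U
    = 1 / real CARD('J) * ((if a = b then centred l a U else 0) + centred l a U)"
  for U :: "real^('J::finite \<times> 'd::finite)"
proof -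
  have d: "centred k a differentiable (at U)" for k a
    by (rule bounded_linear_imp_differentiable[OF bounded_linear_centred])
  have "partial (l, b) (\<lambda>U. empirical_cov U $ a $ b) U
      = 1 / real CARD('J) * partial (l, b) (\<lambda>U. \<Sum>k\<in>UNIV. centred k a U * centred k b U) U"
    unfolding empirical_cov_centred
    by (subst partial_mult[OF differentiable_const])
       (auto intro!: differentiable_sum differentiable_mult d simp: partial_const)
  also have "partial (l, b) (\<lambda>U. \<Sum>k\<in>UNIV. centred k a U * centred k b U) U
      = (\<Sum>k\<in>UNIV. partial (l, b) (\<lambda>U. centred k a U * centred k b U) U)"
    by (intro partial_sum differentiable_mult d)
  also have "\<dots> = (\<Sum>k\<in>UNIV.
      partial (l, b) (centred k a) U * centred k b U + centred k a U * partial (l, b) (centred k b) U)"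
    by (simp add: partial_mult d)
  also have "\<dots> = (\<Sum>k\<in>UNIV. partial (l, b) (centred k a) U * centred k b U)
      + (\<Sum>k\<in>UNIV. centred k a U * partial (l, b) (centred k b) U)"
    by (rule sum.distrib)
  also have "(\<Sum>k\<in>UNIV. partial (l, b) (centred k a) U * centred k b U) = (if a = b then centred l a U else 0)"
    by (simp add: partial_centred left_diff_distrib sum_subtractf sum_centred if_distrib[of "\<lambda>x. x * _"]
        flip: sum_divide_distrib cong: if_cong)
  also have "(\<Sum>k\<in>UNIV. centred k a U * partial (l, b) (centred k b) U) = centred l a U"
    by (simp add: partial_centred right_diff_distrib sum_subtractf sum_centred if_distrib[of "\<lambda>x. _ * x"]
        flip: sum_divide_distrib cong: if_cong)
  finally show ?thesis .
qed

text \<open>The \<open>d + 1\<close> of the drift correction: in \<open>\<Sum>\<^sub>b \<partial>C\<^sub>a\<^sub>b/\<partial>u\<^sub>b\<close> the first factor of \<open>C\<^sub>a\<^sub>b\<close>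
  contributes only for \<open>b = a\<close>, the second for every \<open>b\<close>.\<close>

lemma row_divergence_block_cov:
  "(\<chi> p. \<Sum>q\<in>UNIV. partial q (\<lambda>U. block_cov U $ p $ q) U)
    = ((real CARD('d) + 1) / real CARD('J)) *\<^sub>R (U - mean_copies U)"
  for U :: "real^('J::finite \<times> 'd::finite)"
proof (rule vec_eq_iff[THEN iffD2], safe)
  fix j a
  have "partial (l, b) (\<lambda>U. block_cov U $ (j, a) $ (l, b)) U
      = (if j = l then partial (l, b) (\<lambda>U. empirical_cov U $ a $ b) U else 0)" for l b
    by (simp add: block_cov_def partial_const)
  \<comment> \<open>Off-diagonal blocks are constantly zero, so only block \<open>j\<close> of row
    \<open>(j, a)\<close> survives.\<close>
  then have "(\<Sum>q\<in>UNIV. partial q (\<lambda>U. block_cov U $ (j, a) $ q) U)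
      = (\<Sum>l\<in>UNIV. if j = l then (\<Sum>b\<in>UNIV. partial (l, b) (\<lambda>U. empirical_cov U $ a $ b) U) else 0)"
    by (simp only: UNIV_Times_UNIV[symmetric] sum.cartesian_product')
       (intro sum.cong, auto)
  also have "\<dots> = (real CARD('d) + 1) / real CARD('J) * centred j a U"
    by (simp add: partial_empirical_cov sum.distrib flip: sum_divide_distrib)
       (simp add: field_simps)
  finally show "(\<chi> p. \<Sum>q\<in>UNIV. partial q (\<lambda>U. block_cov U $ p $ q) U) $ (j, a)
    = (((real CARD('d) + 1) / real CARD('J)) *\<^sub>R (U - mean_copies U)) $ (j, a)"
    by (simp add: centred_def mean_copies_def particle_def)
qed

section \<open>The target density\<close>

text \<open>Equal integrals would make the positive function \<open>g - f\<close> vanish almost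
  everywhere, but the whole space is not a Lebesgue null set.\<close>

lemma integral_lborel_strict_mono:
  fixes f g :: "'a::euclidean_space \<Rightarrow> real"
  assumes "integrable lborel f" "integrable lborel g" "\<And>x. f x < g x"
  shows "(LINT x|lborel. f x) < (LINT x|lborel. g x)"
proof -
  have "(LINT x|lborel. g x - f x) \<noteq> 0"
  proof
    assume "(LINT x|lborel. g x - f x) = 0"
    then have "AE x in lborel. g x - f x = 0"
      using assms by (subst (asm) integral_nonneg_eq_0_iff_AE) (auto simp: less_imp_le)
    then have "AE x::'a in lborel. False"
      by (rule eventually_mono) (metis assms(3) eq_iff_diff_eq_0 less_irrefl)
    then show False
      by (auto simp: AE_iff_measurable[OF _ refl])
  qed
  moreover have "0 \<le> (LINT x|lborel. g x - f x)"
    using assms(3) by (intro integral_nonneg_AE) (auto simp: less_imp_le)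
  ultimately show ?thesis using assms by simp
qed

text \<open>Integrability excludes the default value \<open>0\<close> of the Bochner integral, for
  which \<open>target\<close> would divide by zero.\<close>

lemma normalisation_pos:
  fixes \<Psi> :: "real^'d::finite \<Rightarrow> real"
  assumes "integrable lborel (\<lambda>u. exp (- \<Psi> u))"
  shows "0 < (LINT u|lborel. exp (- \<Psi> u))"
proof -
  have "(LINT u::real^'d|lborel. 0::real) < (LINT u|lborel. exp (- \<Psi> u))"
    by (intro integral_lborel_strict_mono assms) auto
  then show ?thesis by simp
qed

lemma joint_target_pos:
  assumes "integrable lborel (\<lambda>u. exp (- \<Psi> u))"
  shows "0 < joint_target \<Psi> U"
  using normalisation_pos[OF assms] by (auto simp: joint_target_def target_def intro!: prod_pos)

text \<open>The right side is spelled with \<open>- 1 *\<close> and with the constant inside the sum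
  so that the closure rules for sums, products and constants apply to it as it stands.\<close>

lemma ln_joint_target:
  assumes "integrable lborel (\<lambda>u. exp (- \<Psi> u))"
  shows "ln (joint_target \<Psi> U)
    = (\<Sum>j\<in>UNIV. - 1 * \<Psi> (particle U j) + - ln (LINT u|lborel. exp (- \<Psi> u)))"
  using normalisation_pos[OF assms]
  by (simp add: joint_target_def target_def ln_prod ln_div)

lemma twice_differentiable_ln_joint_target:
  assumes "integrable lborel (\<lambda>u. exp (- \<Psi> u))" "twice_differentiable \<Psi>"
  shows "twice_differentiable (\<lambda>U. ln (joint_target \<Psi> U))"
  unfolding ln_joint_target[OF assms(1)]
  by (intro twice_differentiable_sum twice_differentiable_add twice_differentiable_mult
      twice_differentiable_const twice_differentiable_compose_particle assms)

text \<open>By \<open>row_divergence_block_cov\<close> the correction is the row divergence of the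
  block covariance, so the general identity applies with \<open>L\<close> the logarithm of the joint
  target.\<close>

lemma fokker_planck_corrected_drift:
  fixes \<rho> :: "real^('J::finite \<times> 'd::finite) \<Rightarrow> real"
  assumes "integrable lborel (\<lambda>u. exp (- \<Psi> u))" "twice_differentiable \<Psi>"
    and "twice_differentiable \<rho>" "\<And>U. 0 < \<rho> U"
  shows "fokker_planck (corrected_drift \<Psi>) block_cov \<rho>
    = flow_form block_cov \<rho> (\<lambda>U. ln (\<rho> U) - ln (joint_target \<Psi> U))"
  using fokker_planck_eq_flow_form[of block_cov "\<lambda>U. ln (joint_target \<Psi> U)" \<rho>] assms
  by (auto simp: fun_eq_iff corrected_drift_def[abs_def] row_divergence_block_cov
      twice_differentiable_block_cov twice_differentiable_ln_joint_target)

section \<open>The first variation of the Kullback--Leibler divergence\<close>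

text \<open>Base \<open>exp 1\<close> makes \<open>log\<close> natural, and the reference measure is
  the first argument of \<open>KL_divergence\<close>.\<close>

lemma kl_energy_eq_KL_divergence:
  fixes \<pi> \<rho> :: "'a::euclidean_space \<Rightarrow> real"
  assumes [measurable]: "\<pi> \<in> borel_measurable borel" "\<rho> \<in> borel_measurable borel"
    and pos: "\<And>x. 0 < \<pi> x" "\<And>x. 0 < \<rho> x"
  shows "kl_energy \<pi> \<rho> = KL_divergence (exp 1) (density lborel \<pi>) (density lborel \<rho>)"
proof -
  have "KL_divergence (exp 1) (density lborel \<pi>) (density lborel \<rho>)
      = (LINT x|lborel. \<rho> x * log (exp 1) (\<rho> x / \<pi> x))"
    using pos by (intro lborel.KL_density_density) (auto simp: less_imp_le less_imp_neq[symmetric])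
  also have "\<dots> = kl_energy \<pi> \<rho>"
    using pos[THEN less_imp_neq] by (simp add: kl_energy_def log_def ln_div)
  finally show ?thesis ..
qed

text \<open>Both follow from \<open>ln y \<le> y - 1\<close>, taken at
  \<open>y = 1 / (1 + x)\<close> for the lower and at \<open>y = 1 + x\<close> for the upper
  bound.\<close>

lemma ln_entropy_bounds:
  fixes x :: real
  assumes "- 1 < x"
  shows "x \<le> (1 + x) * ln (1 + x)" "(1 + x) * ln (1 + x) \<le> x + x\<^sup>2"
proof -
  have "ln (inverse (1 + x)) \<le> inverse (1 + x) - 1"
    using assms by (intro ln_le_minus_one) auto
  then have "1 - inverse (1 + x) \<le> ln (1 + x)"
    using assms by (simp add: ln_inverse)
  then have "(1 + x) * (1 - inverse (1 + x)) \<le> (1 + x) * ln (1 + x)"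
    using assms by (intro mult_left_mono) auto
  then show "x \<le> (1 + x) * ln (1 + x)"
    using assms by (simp add: right_diff_distrib)
  have "ln (1 + x) \<le> x"
    using assms ln_le_minus_one[of "1 + x"] by simp
  then have "(1 + x) * ln (1 + x) \<le> (1 + x) * x"
    using assms by (intro mult_left_mono) auto
  then show "(1 + x) * ln (1 + x) \<le> x + x\<^sup>2"
    by (simp add: algebra_simps power2_eq_square)
qed

lemma has_real_derivative_quadratic_remainder:
  fixes F :: "real \<Rightarrow> real"
  assumes "0 < r" and bound: "\<And>\<epsilon>. \<bar>\<epsilon>\<bar> < r \<Longrightarrow> \<bar>F \<epsilon> - (F 0 + \<epsilon> * D)\<bar> \<le> B * \<epsilon>\<^sup>2"
  shows "(F has_real_derivative D) (at 0)"
proof -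
  have "((\<lambda>\<epsilon>. (F \<epsilon> - F 0) / \<epsilon> - D) \<longlongrightarrow> 0) (at 0)"
  proof (rule Lim_null_comparison)
    show "\<forall>\<^sub>F \<epsilon> in at 0. norm ((F \<epsilon> - F 0) / \<epsilon> - D) \<le> \<bar>B\<bar> * \<bar>\<epsilon>\<bar>"
      unfolding eventually_at
    proof (intro exI conjI ballI impI)
      fix \<epsilon> :: real assume "\<epsilon> \<noteq> 0 \<and> dist \<epsilon> 0 < r"
      then have \<epsilon>: "\<epsilon> \<noteq> 0" "\<bar>\<epsilon>\<bar> < r" by auto
      have "norm ((F \<epsilon> - F 0) / \<epsilon> - D) = \<bar>F \<epsilon> - (F 0 + \<epsilon> * D)\<bar> / \<bar>\<epsilon>\<bar>"
        using \<epsilon> by (simp add: field_simps flip: abs_divide)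
      also have "\<dots> \<le> (B * \<epsilon>\<^sup>2) / \<bar>\<epsilon>\<bar>"
        using \<epsilon> by (intro divide_right_mono bound) auto
      also have "\<dots> = B * \<bar>\<epsilon>\<bar>"
        by (cases "0 \<le> \<epsilon>") (simp_all add: power2_eq_square)
      also have "\<dots> \<le> \<bar>B\<bar> * \<bar>\<epsilon>\<bar>"
        by (intro mult_right_mono) auto
      finally show "norm ((F \<epsilon> - F 0) / \<epsilon> - D) \<le> \<bar>B\<bar> * \<bar>\<epsilon>\<bar>" .
    qed (rule assms)
    show "((\<lambda>\<epsilon>. \<bar>B\<bar> * \<bar>\<epsilon>\<bar>) \<longlongrightarrow> 0) (at 0)"
      by (auto intro!: tendsto_eq_intros)
  qed
  then show ?thesis
    by (simp add: has_field_derivative_iff LIM_zero_iff)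
qed

lemma has_functional_derivative_kl_energy:
  fixes \<pi> \<rho> :: "'a::euclidean_space \<Rightarrow> real"
  assumes [measurable]: "\<pi> \<in> borel_measurable borel" "\<rho> \<in> borel_measurable borel"
    and pos: "\<And>x. 0 < \<rho> x" and int: "integrable lborel \<rho>"
    and fin: "integrable lborel (\<lambda>x. \<rho> x * (ln (\<rho> x) - ln (\<pi> x)))"
  shows "has_functional_derivative (kl_energy \<pi>) \<rho> (\<lambda>x. ln (\<rho> x) - ln (\<pi> x))"
  unfolding has_functional_derivative_def
proof (intro allI impI)
  fix \<phi> assume "perturbation \<rho> \<phi>"
  then have \<phi>: "integrable lborel \<phi>" "(LINT x|lborel. \<phi> x) = 0"
    and "\<forall>\<^sub>F \<epsilon> in at 0. \<forall>x. 0 \<le> \<rho> x + \<epsilon> * \<phi> x"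
    by (auto simp: perturbation_def)
  then obtain e where e: "0 < e" "\<And>\<epsilon> x. \<epsilon> \<noteq> 0 \<Longrightarrow> \<bar>\<epsilon>\<bar> < e \<Longrightarrow> 0 \<le> \<rho> x + \<epsilon> * \<phi> x"
    by (auto simp: eventually_at)
  have [measurable]: "\<phi> \<in> borel_measurable borel"
    using borel_measurable_integrable[OF \<phi>(1)] by simp
  define f where "f x = ln (\<rho> x) - ln (\<pi> x)" for x
  have [measurable]: "f \<in> borel_measurable borel" by (simp add: f_def[abs_def])
  \<comment> \<open>Nonnegativity at \<open>\<epsilon> = e / 2\<close> and at
    \<open>\<epsilon> = - e / 2\<close> yields the two-sided bound \<open>dom\<close> with this
    constant.\<close>
  define K where "K = 2 / e"
  have K: "0 < K" using e by (simp add: K_def)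
  have dom: "\<bar>\<phi> x\<bar> \<le> K * \<rho> x" for x
  proof -
    have "0 \<le> \<rho> x + e / 2 * \<phi> x" "0 \<le> \<rho> x + - e / 2 * \<phi> x"
      using e(1) by (intro e(2); simp)+
    then have "e / 2 * \<bar>\<phi> x\<bar> \<le> \<rho> x" by (cases "0 \<le> \<phi> x") auto
    then show ?thesis using e(1) by (simp add: K_def field_simps)
  qed
  have f\<phi>: "integrable lborel (\<lambda>x. f x * \<phi> x)"
  proof (rule Bochner_Integration.integrable_bound)
    show "integrable lborel (\<lambda>x. K * (\<rho> x * f x))" using fin by (simp add: f_def)
    have "\<bar>f x\<bar> * \<bar>\<phi> x\<bar> \<le> \<bar>f x\<bar> * (K * \<rho> x)" for x by (intro mult_left_mono dom) simp
    then show "AE x in lborel. norm (f x * \<phi> x) \<le> norm (K * (\<rho> x * f x))"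
      using K pos by (simp add: abs_mult less_imp_le mult_ac)
  qed simp
  have "((\<lambda>\<epsilon>. kl_energy \<pi> (\<lambda>x. \<rho> x + \<epsilon> * \<phi> x)) has_real_derivative (LINT x|lborel. f x * \<phi> x)) (at 0)"
  proof (rule has_real_derivative_quadratic_remainder)
    \<comment> \<open>Within this radius \<open>\<bar>\<psi> x\<bar> < 1\<close>, so
      \<open>1 + \<psi> x\<close> is positive and \<open>ln_entropy_bounds\<close> applies.\<close>
    show "0 < 1 / K" using K by simp
    fix \<epsilon> :: real assume \<epsilon>: "\<bar>\<epsilon>\<bar> < 1 / K"
    \<comment> \<open>\<open>\<psi>\<close> is the relative perturbation; \<open>R\<close> is what
      the energy density keeps after its constant and linear terms in \<open>\<epsilon>\<close> are
      removed.\<close>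
    define \<psi> where "\<psi> x = \<epsilon> * \<phi> x / \<rho> x" for x
    define R where "R x = \<rho> x * ((1 + \<psi> x) * ln (1 + \<psi> x) - \<psi> x)" for x
    have [measurable]: "R \<in> borel_measurable borel" by (simp add: R_def[abs_def] \<psi>_def[abs_def])
    have \<psi>: "\<bar>\<psi> x\<bar> \<le> \<bar>\<epsilon>\<bar> * K" for x
      using pos[of x] mult_left_mono[OF dom[of x], of "\<bar>\<epsilon>\<bar>"]
      by (simp add: \<psi>_def abs_mult field_simps)
    have \<psi>1: "- 1 < \<psi> x" for x
    proof -
      have "\<bar>\<epsilon>\<bar> * K < 1" using \<epsilon> K by (simp add: field_simps)
      with \<psi>[of x] show ?thesis by linarith
    qed
    have R0: "0 \<le> R x" for x
      using ln_entropy_bounds(1)[OF \<psi>1[of x]] pos[of x] by (auto simp: R_def)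
    have R1: "R x \<le> \<epsilon>\<^sup>2 * K\<^sup>2 * \<rho> x" for x
    proof -
      have "R x \<le> \<rho> x * (\<psi> x)\<^sup>2"
        unfolding R_def using ln_entropy_bounds(2)[OF \<psi>1[of x]] pos[of x]
        by (intro mult_left_mono) auto
      also have "(\<psi> x)\<^sup>2 \<le> (\<bar>\<epsilon>\<bar> * K)\<^sup>2"
        using \<psi>[of x] by (intro abs_le_square_iff[THEN iffD1]) simp
      finally show ?thesis using pos[of x] by (simp add: power_mult_distrib mult_ac)
    qed
    have R: "integrable lborel R"
    proof (rule Bochner_Integration.integrable_bound)
      show "integrable lborel (\<lambda>x. \<epsilon>\<^sup>2 * K\<^sup>2 * \<rho> x)" using int by simp
      show "AE x in lborel. norm (R x) \<le> norm (\<epsilon>\<^sup>2 * K\<^sup>2 * \<rho> x)"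
        using R0 R1 pos by (simp add: less_imp_le)
    qed simp
    have split: "(\<rho> x + \<epsilon> * \<phi> x) * (ln (\<rho> x + \<epsilon> * \<phi> x) - ln (\<pi> x))
        = \<rho> x * f x + \<epsilon> * (f x * \<phi> x) + \<epsilon> * \<phi> x + R x" for x
    proof -
      have eq: "\<rho> x + \<epsilon> * \<phi> x = \<rho> x * (1 + \<psi> x)"
        using pos[of x] by (simp add: \<psi>_def field_simps)
      have "ln (\<rho> x + \<epsilon> * \<phi> x) = ln (\<rho> x) + ln (1 + \<psi> x)"
        unfolding eq using pos[of x] \<psi>1[of x] by (intro ln_mult_pos) auto
      moreover have "\<epsilon> * \<phi> x = \<rho> x * \<psi> x"
        using pos[of x] by (simp add: \<psi>_def)
      moreover from this have "\<epsilon> * (f x * \<phi> x) = f x * (\<rho> x * \<psi> x)"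
        by (metis mult.left_commute)
      ultimately show ?thesis
        by (simp only: f_def R_def) (simp add: algebra_simps)
    qed
    \<comment> \<open>The term \<open>\<epsilon> * \<phi> x\<close> integrates to zero because a
      perturbation has total mass zero.\<close>
    have "kl_energy \<pi> (\<lambda>x. \<rho> x + \<epsilon> * \<phi> x)
        = kl_energy \<pi> \<rho> + \<epsilon> * (LINT x|lborel. f x * \<phi> x) + (LINT x|lborel. R x)"
      using fin f\<phi> \<phi> R unfolding kl_energy_def split by (simp add: f_def)
    moreover have "0 \<le> (LINT x|lborel. R x)"
      by (simp add: R0)
    moreover have "(LINT x|lborel. R x) \<le> (LINT x|lborel. \<epsilon>\<^sup>2 * K\<^sup>2 * \<rho> x)"
      using R int R1 by (intro integral_mono) auto
    ultimately show "\<bar>kl_energy \<pi> (\<lambda>x. \<rho> x + \<epsilon> * \<phi> x)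
        - (kl_energy \<pi> (\<lambda>x. \<rho> x + 0 * \<phi> x) + \<epsilon> * (LINT x|lborel. f x * \<phi> x))\<bar>
        \<le> (K\<^sup>2 * (LINT x|lborel. \<rho> x)) * \<epsilon>\<^sup>2"
      by (simp add: mult_ac)
  qed
  with f\<phi> show "integrable lborel (\<lambda>x. (ln (\<rho> x) - ln (\<pi> x)) * \<phi> x) \<and>
      ((\<lambda>\<epsilon>. kl_energy \<pi> (\<lambda>x. \<rho> x + \<epsilon> * \<phi> x)) has_real_derivative
        (LINT x|lborel. (ln (\<rho> x) - ln (\<pi> x)) * \<phi> x)) (at 0)"
    by (simp add: f_def)
qed

text \<open>The difference \<open>h\<close> of two functional derivatives is tested against \<open>\<phi> = \<rho> (arctan h - c)\<close>
  with \<open>c\<close> the \<open>\<rho>\<close>-mean of \<open>arctan h\<close>: then \<open>(h - tan c) \<phi>\<close> is nonnegative and integrates to \<open>0\<close>.\<close>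

lemma has_functional_derivative_unique:
  fixes f g \<rho> :: "'a::euclidean_space \<Rightarrow> real"
  assumes f: "has_functional_derivative V \<rho> f" "continuous_on UNIV f"
    and g: "has_functional_derivative V \<rho> g" "continuous_on UNIV g"
    and pos: "\<And>x. 0 < \<rho> x" and int: "integrable lborel \<rho>" and mass: "(LINT x|lborel. \<rho> x) = 1"
  obtains c where "\<And>x. g x = f x + c"
proof -
  define h where "h x = g x - f x" for x
  have hc: "continuous_on UNIV h"
    unfolding h_def by (intro continuous_intros f g)
  have [measurable]: "h \<in> borel_measurable borel"
    by (rule borel_measurable_continuous_onI[OF hc])
  have [measurable]: "\<rho> \<in> borel_measurable lborel" by (rule borel_measurable_integrable[OF int])
  have arctan: "\<bar>arctan y\<bar> < pi / 2" for y
    using arctan_bounded[of y] by auto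
  have ia: "integrable lborel (\<lambda>x. \<rho> x * arctan (h x))"
  proof (rule Bochner_Integration.integrable_bound)
    show "integrable lborel (\<lambda>x. pi / 2 * \<rho> x)" using int by simp
    show "AE x in lborel. norm (\<rho> x * arctan (h x)) \<le> norm (pi / 2 * \<rho> x)"
      using pos arctan by (auto simp: abs_mult less_imp_le intro!: mult_mono)
  qed simp
  define c where "c = (LINT x|lborel. \<rho> x * arctan (h x))"
  \<comment> \<open>The strict bounds on \<open>arctan\<close> pass to its mean, since
    \<open>\<rho>\<close> has mass \<open>1\<close>; thus \<open>c\<close> lies where
    \<open>arctan (tan c) = c\<close>.\<close>
  have "(LINT x|lborel. \<rho> x * arctan (h x)) < (LINT x|lborel. \<rho> x * (pi / 2))"
    using pos arctan_ubound int by (intro integral_lborel_strict_mono ia) auto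
  moreover have "(LINT x|lborel. \<rho> x * (- (pi / 2))) < (LINT x|lborel. \<rho> x * arctan (h x))"
    using int by (intro integral_lborel_strict_mono ia mult_strict_left_mono arctan_lbound pos) simp
  ultimately have c: "- (pi / 2) < c" "c < pi / 2"
    using mass by (simp_all add: c_def)
  define \<phi> where "\<phi> x = \<rho> x * (arctan (h x) - c)" for x
  have i\<phi>: "integrable lborel \<phi>"
    using ia int by (simp add: \<phi>_def[abs_def] right_diff_distrib)
  have "(LINT x|lborel. \<phi> x) = 0"
    using ia int mass by (simp add: \<phi>_def right_diff_distrib c_def)
  moreover have "\<forall>\<^sub>F \<epsilon> in at 0. \<forall>x. 0 \<le> \<rho> x + \<epsilon> * \<phi> x"
    unfolding eventually_at
  proof (intro exI conjI ballI impI allI)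
    \<comment> \<open>The radius comes from \<open>\<bar>arctan (h x) - c\<bar> \<le> pi\<close>,
      both numbers lying within \<open>pi / 2\<close> of \<open>0\<close>.\<close>
    show "0 < 1 / pi" by simp
    fix \<epsilon> :: real and x assume "\<epsilon> \<noteq> 0 \<and> dist \<epsilon> 0 < 1 / pi"
    then have "\<bar>\<epsilon>\<bar> < 1 / pi" by simp
    moreover have "\<bar>arctan (h x) - c\<bar> \<le> pi" using arctan[of "h x"] c by linarith
    ultimately have "\<bar>\<epsilon>\<bar> * \<bar>arctan (h x) - c\<bar> \<le> 1 / pi * pi" by (intro mult_mono) auto
    then have "\<bar>\<epsilon> * (arctan (h x) - c)\<bar> \<le> 1" by (simp add: abs_mult)
    then have "0 \<le> \<rho> x * (1 + \<epsilon> * (arctan (h x) - c))" 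
      using pos[of x] by (intro mult_nonneg_nonneg) auto
    then show "0 \<le> \<rho> x + \<epsilon> * \<phi> x" by (simp add: \<phi>_def algebra_simps)
  qed
  ultimately have "perturbation \<rho> \<phi>" using i\<phi> by (simp add: perturbation_def)
  \<comment> \<open>Both integrals are the derivative at \<open>0\<close> of the same function of
    \<open>\<epsilon>\<close>, so they agree.\<close>
  with f(1) g(1) have "integrable lborel (\<lambda>x. f x * \<phi> x)" "integrable lborel (\<lambda>x. g x * \<phi> x)"
    and "(LINT x|lborel. f x * \<phi> x) = (LINT x|lborel. g x * \<phi> x)"
    unfolding has_functional_derivative_def by (blast intro: DERIV_unique)+
  then have ih: "integrable lborel (\<lambda>x. (h x - tan c) * \<phi> x)" "(LINT x|lborel. (h x - tan c) * \<phi> x) = 0"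
    using i\<phi> \<open>(LINT x|lborel. \<phi> x) = 0\<close> by (simp_all add: h_def left_diff_distrib)
  \<comment> \<open>As \<open>arctan\<close> is increasing, \<open>h x - tan c\<close> and
    \<open>arctan (h x) - c\<close> have the same sign and vanish together.\<close>
  have tan: "arctan y \<le> c \<longleftrightarrow> y \<le> tan c" "c \<le> arctan y \<longleftrightarrow> tan c \<le> y" for y
    using arctan_le_iff[of y "tan c"] arctan_le_iff[of "tan c" y] arctan_tan[OF c] by simp_all
  have "0 \<le> (h x - tan c) * (arctan (h x) - c)" for x
    using tan[of "h x"] by (cases "h x \<le> tan c") (auto intro: mult_nonneg_nonneg mult_nonpos_nonpos)
  then have "0 \<le> (h x - tan c) * \<phi> x" for x
    using pos[of x] by (simp add: \<phi>_def mult.left_commute)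
  then have "AE x in lborel. (h x - tan c) * \<phi> x = 0"
    using ih by (subst (asm) integral_nonneg_eq_0_iff_AE) auto
  moreover have "h x = tan c" if "(h x - tan c) * \<phi> x = 0" for x
    using that pos[of x] tan[of "h x"] by (auto simp: \<phi>_def)
  ultimately have "AE x in lborel. x \<in> {x. h x = tan c}"
    by auto
  then have "AE x in lebesgue. x \<in> {x. h x = tan c}"
    by (rule AE_completion)
  \<comment> \<open>A closed set of full Lebesgue measure is the whole space; continuity of
    \<open>h\<close> thus upgrades equality almost everywhere to equality everywhere.\<close>
  moreover have "closed {x. h x = tan c}"
    by (intro closed_Collect_eq hc continuous_on_const)
  ultimately have "h x = tan c" for x
    using mem_closed_if_AE_lebesgue by blast
  then show ?thesis
    by (intro that[of "tan c"]) (simp add: h_def algebra_simps)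
qed

section \<open>The corrected interacting particle system\<close>

text \<open>A functional derivative is fixed only up to a constant, so the flow form must not see
  constants.\<close>

lemma flow_form_add_const: "flow_form S \<rho> (\<lambda>x. f x + c) = flow_form S \<rho> f"
proof -
  have add: "((\<lambda>h. u h + k) has_real_derivative D) (at 0)" if "(u has_real_derivative D) (at 0)"
    for u :: "real \<Rightarrow> real" and k D
    using that by (auto intro!: derivative_eq_intros)
  \<comment> \<open>\<open>deriv\<close> is a choice among derivatives: equal sets of candidates
    give equal choices, also where no derivative exists.\<close>
  have "((\<lambda>h. u h + c) has_real_derivative D) (at 0) \<longleftrightarrow> (u has_real_derivative D) (at 0)"
    for u :: "real \<Rightarrow> real" and D
    using add[of u D c] add[of "\<lambda>h. u h + c" D "- c"] by auto
  then have "grad (\<lambda>x. f x + c) = grad f"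
    by (simp add: grad_def partial_def deriv_def fun_eq_iff)
  then show ?thesis
    by (simp add: flow_form_def)
qed

text \<open>The operator identity holds at every time in \<open>T\<close>, so for the given curve
  both evolution equations hold or fail together. In the second form any continuous representative
  of the first variation may stand, as two of them differ by a constant.\<close>

theorem lemma2p3:
  fixes \<Psi> :: "real^'d::finite \<Rightarrow> real"
    and \<mu> :: "real \<Rightarrow> real^('J::finite \<times> 'd) \<Rightarrow> real"
    and T :: "real set"
  assumes "twice_differentiable \<Psi>"
    and "integrable lborel (\<lambda>u. exp (- \<Psi> u))"
    and "\<And>t. t \<in> T \<Longrightarrow> twice_differentiable (\<mu> t)"
    and "\<And>t U. t \<in> T \<Longrightarrow> 0 < \<mu> t U"
    and "\<And>t. t \<in> T \<Longrightarrow> integrable lborel (\<mu> t)"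
    and "\<And>t. t \<in> T \<Longrightarrow> (LINT U|lborel. \<mu> t U) = 1"
  shows
    "(\<forall>t\<in>T. fokker_planck (corrected_drift \<Psi>) block_cov (\<mu> t)
        = flow_form block_cov (\<mu> t) (\<lambda>U. ln (\<mu> t U) - ln (joint_target \<Psi> U))) \<and>
     (evolves T (\<lambda>t. fokker_planck (corrected_drift \<Psi>) block_cov (\<mu> t)) \<mu> \<longleftrightarrow>
      evolves T (\<lambda>t. flow_form block_cov (\<mu> t) (\<lambda>U. ln (\<mu> t U) - ln (joint_target \<Psi> U))) \<mu>) \<and>
     (\<forall>t\<in>T. kl_energy (joint_target \<Psi>) (\<mu> t)
        = KL_divergence (exp 1) (density lborel (joint_target \<Psi>)) (density lborel (\<mu> t))) \<and>
     ((\<forall>t\<in>T. integrable lborel (\<lambda>U. \<mu> t U * (ln (\<mu> t U) - ln (joint_target \<Psi> U)))) \<longrightarrow>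
        (\<forall>t\<in>T. has_functional_derivative (kl_energy (joint_target \<Psi>)) (\<mu> t)
           (\<lambda>U. ln (\<mu> t U) - ln (joint_target \<Psi> U))) \<and>
        (\<forall>\<delta>V. (\<forall>t\<in>T. has_functional_derivative (kl_energy (joint_target \<Psi>)) (\<mu> t) (\<delta>V t) \<and>
                     continuous_on UNIV (\<delta>V t)) \<longrightarrow>
           (\<forall>t\<in>T. fokker_planck (corrected_drift \<Psi>) block_cov (\<mu> t)
              = flow_form block_cov (\<mu> t) (\<delta>V t)) \<and>
           (evolves T (\<lambda>t. fokker_planck (corrected_drift \<Psi>) block_cov (\<mu> t)) \<mu> \<longleftrightarrow>
            evolves T (\<lambda>t. flow_form block_cov (\<mu> t) (\<delta>V t)) \<mu>)))"
proof -
  define L where "L t U = ln (\<mu> t U) - ln (joint_target \<Psi> U)" for t U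
  note int = assms(2) and \<mu> = assms(3,4)
  have fp: "fokker_planck (corrected_drift \<Psi>) block_cov (\<mu> t) = flow_form block_cov (\<mu> t) (L t)"
    if "t \<in> T" for t
    unfolding L_def using that assms(1,2) \<mu> by (intro fokker_planck_corrected_drift)
  have \<pi>: "0 < joint_target \<Psi> U" for U :: "real^('J \<times> 'd)"
    by (rule joint_target_pos[OF int])
  have lnc: "continuous_on UNIV (\<lambda>U :: real^('J \<times> 'd). ln (joint_target \<Psi> U))"
    by (intro twice_differentiable_imp_continuous_on twice_differentiable_ln_joint_target assms)
  \<comment> \<open>Continuity of the joint target is recovered from that of its logarithm, since
    \<open>exp\<close> inverts \<open>ln\<close> on positive values.\<close>
  have "continuous_on UNIV (\<lambda>U :: real^('J \<times> 'd). exp (ln (joint_target \<Psi> U)))"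
    by (intro continuous_on_exp lnc)
  then have \<pi>m: "joint_target \<Psi> \<in> borel_measurable (borel :: (real^('J \<times> 'd)) measure)"
    by (intro borel_measurable_continuous_onI) (simp add: \<pi>)
  have \<mu>c: "continuous_on UNIV (\<mu> t)" if "t \<in> T" for t
    by (intro twice_differentiable_imp_continuous_on \<mu> that)
  have \<mu>m: "\<mu> t \<in> borel_measurable borel" if "t \<in> T" for t
    by (intro borel_measurable_continuous_onI \<mu>c that)
  have Lc: "continuous_on UNIV (L t)" if "t \<in> T" for t
    unfolding L_def using \<mu>(2)[OF that] by (intro continuous_intros \<mu>c that lnc) (auto simp: less_imp_neq[symmetric])
  have kl: "kl_energy (joint_target \<Psi>) (\<mu> t)
      = KL_divergence (exp 1) (density lborel (joint_target \<Psi>)) (density lborel (\<mu> t))"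
    if "t \<in> T" for t
    by (intro kl_energy_eq_KL_divergence \<pi>m \<mu>m \<pi> \<mu> that)
  have fd: "has_functional_derivative (kl_energy (joint_target \<Psi>)) (\<mu> t) (L t)"
    if "t \<in> T" "integrable lborel (\<lambda>U. \<mu> t U * (ln (\<mu> t U) - ln (joint_target \<Psi> U)))" for t
    unfolding L_def using that(2) by (intro has_functional_derivative_kl_energy \<pi>m \<mu>m \<mu> assms(5) that(1))
  have unique: "fokker_planck (corrected_drift \<Psi>) block_cov (\<mu> t) = flow_form block_cov (\<mu> t) f"
    if t: "t \<in> T" and i: "integrable lborel (\<lambda>U. \<mu> t U * (ln (\<mu> t U) - ln (joint_target \<Psi> U)))"
      and f: "has_functional_derivative (kl_energy (joint_target \<Psi>)) (\<mu> t) f" "continuous_on UNIV f" for t f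
  proof -
    obtain c where "\<And>U. f U = L t U + c"
      using has_functional_derivative_unique[OF fd[OF t i] Lc[OF t] f \<mu>(2)[OF t]
          assms(5,6)[OF t]] by blast
    then have "f = (\<lambda>U. L t U + c)" by auto
    then show ?thesis by (simp add: fp[OF t] flow_form_add_const)
  qed
  \<comment> \<open>\<open>evolves\<close> reads its right-hand side only at times in
    \<open>T\<close>.\<close>
  have evolves_cong: "evolves T r \<mu> \<longleftrightarrow> evolves T r' \<mu>" if "\<And>t. t \<in> T \<Longrightarrow> r t = r' t" for r r'
    using that by (simp add: evolves_def)
  show ?thesis
    unfolding L_def[symmetric]
    by (intro conjI ballI impI allI evolves_cong; (intro fp kl fd unique)?; auto simp: L_def)
qed

end
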